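(* For all integers $a, b \geq 11$ we have $N(0,2;a)\,N(0,2;b) > N(0,2;a+b)$, and for all integers $a, b \geq 12$ we have $N(1,2;a)\,N(1,2;b) > N(1,2;a+b)$.
   Context: A partition of $n$ is a finite nondecreasing list of positive integers $\lambda = (\lambda_1 \le \dots \le \lambda_k)$ summing to $n$; its rank is $\lambda_k - k$ (largest part minus number of parts). $N(r,2;n)$ denotes the number of partitions of $n$ whose rank is congruent to $r$ modulo $2$. *)

theory Defs
  imports "HOL-Number_Theory.Cong"
begin

definition partition_of :: "nat \<Rightarrow> nat list \<Rightarrow> bool" where
  "partition_of n xs \<longleftrightarrow> sorted xs \<and> 0 \<notin> set xs \<and> sum_list xs = n"

(* Since a partition is listed in nondecreasing order, its largest part is the last entry.
   The value at the empty list is unspecified; it concerns only the partition of 0. *)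
definition partition_rank :: "nat list \<Rightarrow> int" where
  "partition_rank xs = int (last xs) - int (length xs)"

(* rank_count r m n is N(r,m;n). *)
definition rank_count :: "int \<Rightarrow> int \<Rightarrow> nat \<Rightarrow> nat" where
  "rank_count r m n = card {xs. partition_of n xs \<and> [partition_rank xs = r] (mod m)}"

(* So the cardinality above is never that of an infinite set. *)
lemma finite_partitions: "finite {xs. partition_of n xs}"
proof (rule finite_subset)
  have len: "length xs \<le> sum_list xs" if "0 \<notin> set xs" for xs :: "nat list"
    using that by (induction xs) auto
  show "{xs. partition_of n xs} \<subseteq> {xs. set xs \<subseteq> {..n} \<and> length xs \<le> n}"
    using len by (auto simp: partition_of_def member_le_sum_list)
  show "finite {xs. set xs \<subseteq> {..n} \<and> length xs \<le> n}"
    by (rule finite_lists_length_le) simp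
qed

end

theory Submission
  imports Defs "HOL-Computational_Algebra.Formal_Power_Series"
begin

text \<open>
  Let \<open>p(n)\<close> be the number of partitions of \<open>n\<close> and \<open>\<alpha>(n)\<close> the sum of \<open>(-1)\<close> to the rank over them, so
  that \<open>2 N(0,2;n) = p(n) + \<alpha>(n)\<close> and \<open>2 N(1,2;n) = p(n) - \<alpha>(n)\<close>. Fixing the largest part and cancelling
  parts \<open>1 + 1\<close> against parts \<open>2\<close> gives \<open>|\<alpha>(n)| \<le> p(n) - p(n-2) + 1\<close>. Euler's recurrence
  \<open>n p(n) = \<Sum>\<^sub>k \<sigma>(k) p(n-k)\<close> propagates inequalities between values of \<open>p\<close> by induction, up to boundary
  terms that are negligible because \<open>p\<close> grows faster than \<open>n\<^sup>2\<close>. It yields \<open>2 p(n) + 3 \<le> 3 p(n-2)\<close> for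
  \<open>n \<ge> 31\<close>, whence \<open>3 |\<alpha>(n)| \<le> p(n)\<close>, and \<open>7 p(a+b) \<le> p(a) p(b)\<close> for \<open>a \<ge> 11\<close>, \<open>b \<ge> 31\<close>. Together these
  settle all cases with \<open>max a b \<ge> 31\<close>; the others, and the starting ranges of the inductions, are read off
  from tables.
\<close>

section \<open>Partitions with bounded parts and their weighted counts\<close>

definition bounded_partitions :: "nat \<Rightarrow> nat \<Rightarrow> nat list set" where
  "bounded_partitions m n = {xs. partition_of n xs \<and> (\<forall>x\<in>set xs. x \<le> m)}"

lemma finite_bounded_partitions [simp]: "finite (bounded_partitions m n)"
  by (rule finite_subset[OF _ finite_partitions[of n]]) (auto simp: bounded_partitions_def)

lemma bounded_partitions_0: "bounded_partitions 0 n = (if n = 0 then {[]} else {})"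
proof -
  have "xs \<in> bounded_partitions 0 n \<longleftrightarrow> xs = [] \<and> n = 0" for xs
    by (cases xs) (auto simp: bounded_partitions_def partition_of_def)
  then show ?thesis by auto
qed

text \<open>Either no part equals \<open>Suc m\<close>, or sortedness makes \<open>Suc m\<close> the
  last entry; removing it leaves a partition whose parts may still be as large as
  \<open>Suc m\<close>.\<close>

lemma bounded_partitions_Suc:
  "bounded_partitions (Suc m) n = bounded_partitions m n \<union>
     (if Suc m \<le> n then (\<lambda>ys. ys @ [Suc m]) ` bounded_partitions (Suc m) (n - Suc m) else {})"
  (is "?L = ?A \<union> ?B")
proof (intro equalityI subsetI)
  fix xs assume xs: "xs \<in> ?L"
  show "xs \<in> ?A \<union> ?B"
  proof (cases "Suc m \<in> set xs")
    case False
    then show ?thesis using xs by (auto simp: bounded_partitions_def le_Suc_eq)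
  next
    case True
    then have ne: "xs \<noteq> []" by auto
    define ys where "ys = butlast xs"
    have eq: "xs = ys @ [last xs]" using ne by (simp add: ys_def)
    have "last xs \<le> Suc m" using xs ne by (auto simp: bounded_partitions_def)
    moreover have "Suc m \<le> last xs"
    proof -
      have "sorted (ys @ [last xs])" "Suc m \<in> set (ys @ [last xs])"
        using xs True eq by (auto simp: bounded_partitions_def partition_of_def)
      then show ?thesis by (auto simp: sorted_append)
    qed
    ultimately have eq': "xs = ys @ [Suc m]" using eq by auto
    have "ys \<in> bounded_partitions (Suc m) (n - Suc m)" "Suc m \<le> n"
      using xs unfolding eq' by (auto simp: bounded_partitions_def partition_of_def sorted_append)
    then show ?thesis using eq' by auto
  qed
next
  fix xs assume "xs \<in> ?A \<union> ?B"
  then show "xs \<in> ?L"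
    by (auto simp: bounded_partitions_def partition_of_def sorted_append le_SucI split: if_splits)
qed

lemma bounded_partitions_Suc_disjoint:
  "bounded_partitions m n \<inter> (\<lambda>ys. ys @ [Suc m]) ` B = {}"
  by (auto simp: bounded_partitions_def)

lemma sum_bounded_partitions_Suc:
  fixes h :: "nat list \<Rightarrow> int"
  shows "(\<Sum>xs\<in>bounded_partitions (Suc m) n. h xs) = (\<Sum>xs\<in>bounded_partitions m n. h xs) +
    (if Suc m \<le> n then \<Sum>ys\<in>bounded_partitions (Suc m) (n - Suc m). h (ys @ [Suc m]) else 0)"
proof -
  have "inj_on (\<lambda>ys. ys @ [Suc m]) B" for B by (auto simp: inj_on_def)
  then show ?thesis
    by (subst bounded_partitions_Suc)
      (auto simp: sum.union_disjoint bounded_partitions_Suc_disjoint sum.reindex)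
qed

lemma bounded_partitions_ge:
  assumes "n \<le> m" shows "bounded_partitions m n = {xs. partition_of n xs}"
  using assms member_le_sum_list[where 'a = nat]
  by (fastforce simp: bounded_partitions_def partition_of_def)

text \<open>The coefficient of q^n in the product of 1/(1 - e q^j) over 1 \<le> j \<le> m. Only e =
  1 (plain counting) and e = -1 (sign by the number of parts) occur in the proof.\<close>

definition weighted_count :: "int \<Rightarrow> nat \<Rightarrow> nat \<Rightarrow> int" where
  "weighted_count e m n = (\<Sum>xs\<in>bounded_partitions m n. e ^ length xs)"

text \<open>At \<open>n = 0\<close> the value involves \<^term>\<open>last []\<close>, so it is only meaningful for positive \<open>n\<close>.\<close>
definition signed_count :: "nat \<Rightarrow> nat \<Rightarrow> int" where
  "signed_count m n = (\<Sum>xs\<in>bounded_partitions m n. (-1) ^ (last xs + length xs))"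

definition partitions :: "nat \<Rightarrow> int" where
  "partitions n = weighted_count 1 n n"

definition rank_excess :: "nat \<Rightarrow> int" where
  "rank_excess n = signed_count n n"

lemma weighted_count_0: "weighted_count e 0 n = (if n = 0 then 1 else 0)"
  by (simp add: weighted_count_def bounded_partitions_0)

lemma weighted_count_Suc:
  "weighted_count e (Suc m) n = weighted_count e m n +
     (if Suc m \<le> n then e * weighted_count e (Suc m) (n - Suc m) else 0)"
  unfolding weighted_count_def
  by (subst sum_bounded_partitions_Suc) (simp add: sum_distrib_left)

lemma signed_count_0: "0 < n \<Longrightarrow> signed_count 0 n = 0"
  by (simp add: signed_count_def bounded_partitions_0)

text \<open>Appending \<open>Suc m\<close> to \<open>ys\<close> gives the sign exponent
  \<open>Suc m + length ys + 1\<close>; modulo 2 the two increments cancel, so the largest part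
  contributes only the fixed factor \<open>(-1) ^ m\<close>.\<close>

lemma signed_count_Suc:
  "signed_count (Suc m) n = signed_count m n +
     (if Suc m \<le> n then (-1) ^ m * weighted_count (-1) (Suc m) (n - Suc m) else 0)"
  unfolding signed_count_def weighted_count_def
  by (subst sum_bounded_partitions_Suc) (simp add: sum_distrib_left power_add)

lemma weighted_count_nonneg: "0 \<le> weighted_count 1 m n"
  by (simp add: weighted_count_def)

lemma weighted_count_ge: "n \<le> m \<Longrightarrow> weighted_count 1 m n = partitions n"
  by (simp add: partitions_def weighted_count_def bounded_partitions_ge)

lemma signed_count_ge: "n \<le> m \<Longrightarrow> signed_count m n = rank_excess n"
  by (simp add: rank_excess_def signed_count_def bounded_partitions_ge)

lemma rank_count_partitions:
  "2 * int (rank_count 0 2 n) = partitions n + rank_excess n"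
  "2 * int (rank_count 1 2 n) = partitions n - rank_excess n"
proof -
  let ?P = "{xs. partition_of n xs}" and ?e = "\<lambda>xs::nat list. even (last xs + length xs)"
  have fin: "finite ?P" by (rule finite_partitions)
  have cong0: "[partition_rank xs = 0] (mod 2) \<longleftrightarrow> ?e xs" for xs
    by (auto simp: cong_0_iff partition_rank_def)
  have cong1: "[partition_rank xs = 1] (mod 2) \<longleftrightarrow> \<not> ?e xs" for xs
    unfolding cong_def partition_rank_def by presburger
  have c0: "int (rank_count 0 2 n) = (\<Sum>xs\<in>?P. if ?e xs then 1 else 0)"
    unfolding rank_count_def cong0 using fin by (simp add: sum.If_cases Int_def)
  have c1: "int (rank_count 1 2 n) = (\<Sum>xs\<in>?P. if ?e xs then 0 else 1)"
    unfolding rank_count_def cong1 using fin by (simp add: sum.If_cases Int_def)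
  have p: "partitions n = (\<Sum>xs\<in>?P. 1)"
    by (simp add: partitions_def weighted_count_def bounded_partitions_ge)
  have r: "rank_excess n = (\<Sum>xs\<in>?P. if ?e xs then 1 else - 1)"
    unfolding rank_excess_def signed_count_def bounded_partitions_ge[OF order_refl]
    by (rule sum.cong) auto
  show "2 * int (rank_count 0 2 n) = partitions n + rank_excess n"
    unfolding c0 p r sum.distrib[symmetric] sum_distrib_left by (rule sum.cong) auto
  show "2 * int (rank_count 1 2 n) = partitions n - rank_excess n"
    unfolding c1 p r sum_subtractf[symmetric] sum_distrib_left by (rule sum.cong) auto
qed

section \<open>Cancellation in the rank parity\<close>

text \<open>The generating function is (1 - q^2) times the product of 1/(1 - q^j) over 1 \<le> j
  \<le> m. For m \<ge> 2 the factor for j = 2 cancels, so partitions with no part 2 are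
  counted.\<close>

definition gap :: "nat \<Rightarrow> nat \<Rightarrow> int" where
  "gap m n = weighted_count 1 m n - (if 2 \<le> n then weighted_count 1 m (n - 2) else 0)"

lemma gap_Suc: "gap (Suc m) n = gap m n + (if Suc m \<le> n then gap (Suc m) (n - Suc m) else 0)"
proof -
  have "n - 2 - Suc m = n - Suc m - 2" by simp
  then show ?thesis
    unfolding gap_def
    by (subst (1 2) weighted_count_Suc) auto
qed

lemma weighted_count_1: "weighted_count e (Suc 0) n = e ^ n"
  by (induction n) (simp_all add: weighted_count_Suc[of e 0] weighted_count_0)

text \<open>Here 1/((1 + q)(1 + q^2)) = (1 - q)/(1 - q^4) has coefficients 0 and \<plusminus>1,
  while only the partition into ones avoids the part 2, so the gap is 1.\<close>

lemma abs_weighted_count_2: "\<bar>weighted_count (-1) 2 n\<bar> \<le> gap 2 n"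
proof -
  have rec: "weighted_count e 2 n = e ^ n + (if 2 \<le> n then e * weighted_count e 2 (n - 2) else 0)"
    for e n
    using weighted_count_Suc[of e "Suc 0" n] by (simp add: weighted_count_1 numeral_2_eq_2)
  have "gap 2 n = 1"
    unfolding gap_def by (subst rec) auto
  \<comment> \<open>Keeping the exact sign makes the induction close: the recursion swaps the values
    0 and \<open>(-1) ^ n\<close>.\<close>
  moreover have "weighted_count (-1) 2 n \<in> {0, (-1) ^ n}"
  proof (induction n rule: less_induct)
    case (less n)
    show ?case
    proof (cases "2 \<le> n")
      case True
      then have "weighted_count (-1) 2 (n - 2) \<in> {0, (-1) ^ n}"
        using less[of "n - 2"] by (simp add: power_diff)
      then show ?thesis using True by (subst rec) auto
    qed (subst rec, simp)
  qed
  then have "\<bar>weighted_count (-1) 2 n\<bar> \<le> 1" by auto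
  ultimately show ?thesis by simp
qed

text \<open>Up to a sign, both sides obey the same recursion in m, so the triangle inequality
  carries the bound upwards. It starts at m = 2 because \<open>gap 1 n\<close> is 0 for n \<ge>
  2.\<close>

lemma abs_weighted_count_le_gap:
  assumes "2 \<le> m" shows "\<bar>weighted_count (-1) m n\<bar> \<le> gap m n"
  using assms
proof (induction m arbitrary: n rule: dec_induct)
  case base
  show ?case by (rule abs_weighted_count_2)
next
  case (step m)
  show ?case
  proof (induction n rule: less_induct)
    case (less n)
    have "\<bar>weighted_count (-1) (Suc m) (n - Suc m)\<bar> \<le> gap (Suc m) (n - Suc m)" if "Suc m \<le> n"
      using less[of "n - Suc m"] that by simp
    with step.IH[of n] show ?case
      unfolding weighted_count_Suc[of _ m n] gap_Suc[of m n] by (auto simp: abs_le_iff)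
  qed
qed

text \<open>The summand 1 pays for the partition into ones, the case m = 1 with gap 0. Each further
  largest part costs at most the increment of the gap.\<close>

lemma abs_signed_count_le_gap:
  assumes "1 \<le> m" "2 \<le> n" shows "\<bar>signed_count m n\<bar> \<le> gap m n + 1"
  using assms(1)
proof (induction m rule: dec_induct)
  case base
  show ?case
    using assms(2) signed_count_Suc[of 0 n]
    by (simp add: gap_def weighted_count_1 signed_count_0 power_abs)
next
  case (step m)
  have "\<bar>(-1) ^ m * weighted_count (-1) (Suc m) (n - Suc m)\<bar> \<le> gap (Suc m) (n - Suc m)"
    using abs_weighted_count_le_gap[of "Suc m"] step.hyps by (simp add: abs_mult power_abs)
  with step.IH show ?case
    unfolding signed_count_Suc[of m n] gap_Suc[of m n] by auto
qed

lemma abs_rank_excess_le: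
  assumes "2 \<le> n" shows "\<bar>rank_excess n\<bar> \<le> partitions n - partitions (n - 2) + 1"
  using abs_signed_count_le_gap[of n n] assms
  by (simp add: gap_def rank_excess_def weighted_count_ge)

section \<open>Euler's recurrence\<close>

definition divisor_sum :: "nat \<Rightarrow> int" where
  "divisor_sum k = (\<Sum>d | d dvd k. int d)"

text \<open>The coefficients of the sum over d \<le> m of d q^d/(1 - q^d), which has no constant
  term; k = 0 is separated because every d divides 0.\<close>

definition divisor_sum_upto :: "nat \<Rightarrow> nat \<Rightarrow> int" where
  "divisor_sum_upto m k = (if k = 0 then 0 else \<Sum>d | d dvd k \<and> d \<le> m. int d)"

lemma divisor_sum_upto_Suc:
  "divisor_sum_upto (Suc m) k =
     divisor_sum_upto m k + (if 0 < k \<and> Suc m dvd k then int (Suc m) else 0)"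
proof -
  have "{d. d dvd k \<and> d \<le> Suc m} =
      {d. d dvd k \<and> d \<le> m} \<union> (if Suc m dvd k then {Suc m} else {})"
    by (auto simp: le_Suc_eq)
  then show ?thesis
    by (auto simp: divisor_sum_upto_def)
qed

lemma fps_X_deriv_nth: "fps_nth (fps_X * fps_deriv f) n = of_nat n * fps_nth f n"
  by (cases n) simp_all

text \<open>The logarithmic derivative of the product of 1/(1 - q^j), with the denominator cleared.
  Each induction step adds one factor 1/Q with Q = 1 - q^M.\<close>

lemma weighted_count_deriv:
  defines "C \<equiv> \<lambda>m. Abs_fps (weighted_count 1 m)"
  shows "fps_X * fps_deriv (C m) = Abs_fps (divisor_sum_upto m) * C m"
proof (induction m)
  case 0
  have "C 0 = 1"
    by (rule fps_ext) (simp add: C_def weighted_count_0)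
  moreover have "Abs_fps (divisor_sum_upto 0) = 0"
    by (rule fps_ext) (auto simp: divisor_sum_upto_def sum.neutral)
  ultimately show ?case by simp
next
  case (Suc m)
  define M where "M = Suc m"
  define Q :: "int fps" where "Q = 1 - fps_X ^ M"
  have C: "C M * Q = C m"
    by (rule fps_ext)
      (simp add: Q_def C_def M_def right_diff_distrib fps_X_power_mult_right_nth
        weighted_count_Suc[of 1 m] del: power_Suc)
  have W: "Abs_fps (divisor_sum_upto M) * Q =
      Abs_fps (divisor_sum_upto m) * Q + fps_const (int M) * fps_X ^ M"
  proof -
    \<comment> \<open>\<open>U\<close> is the geometric series q^M/(1 - q^M).\<close>
    define U where "U = Abs_fps (\<lambda>k. if 0 < k \<and> M dvd k then 1 else 0 :: int)"
    have "U * Q = fps_X ^ M"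
    proof (rule fps_ext)
      fix k
      show "fps_nth (U * Q) k = fps_nth (fps_X ^ M) k"
        by (cases "k < M"; cases "k = M")
          (auto simp: U_def Q_def M_def right_diff_distrib fps_X_power_mult_right_nth
            simp del: power_Suc dest: dvd_imp_le dvd_diffD)
    qed
    moreover have "Abs_fps (divisor_sum_upto M) = Abs_fps (divisor_sum_upto m) + fps_const (int M) * U"
      by (rule fps_ext) (simp add: U_def M_def divisor_sum_upto_Suc)
    ultimately show ?thesis by (simp add: algebra_simps)
  qed
  have dQ: "fps_X * fps_deriv Q = - (fps_const (int M) * fps_X ^ M)"
    by (rule fps_ext) (auto simp: fps_X_deriv_nth Q_def M_def simp del: power_Suc)
  \<comment> \<open>This allows cancelling \<open>Q\<close> from the identity obtained by the
    product rule below.\<close>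
  have "fps_nth Q 0 = 1" by (simp add: Q_def M_def)
  then have "Q \<noteq> 0" by auto
  have "fps_X * fps_deriv (C M) * Q = fps_X * fps_deriv (C M * Q) - C M * (fps_X * fps_deriv Q)"
    by (simp add: algebra_simps)
  also have "\<dots> = Abs_fps (divisor_sum_upto m) * (C M * Q) + fps_const (int M) * fps_X ^ M * C M"
    using Suc C dQ by (simp add: algebra_simps)
  also have "\<dots> = Abs_fps (divisor_sum_upto M) * Q * C M"
    unfolding W by (simp add: algebra_simps)
  finally show ?case
    using \<open>Q \<noteq> 0\<close> by (simp add: M_def algebra_simps)
qed

text \<open>Compare coefficients of q^n in the preceding identity for m = n, where the bound on
  parts and divisors is no restriction.\<close>

lemma euler_recurrence:
  "int n * partitions n = (\<Sum>k=1..n. divisor_sum k * partitions (n - k))"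
proof -
  have "int n * weighted_count 1 n n = (\<Sum>k=0..n. divisor_sum_upto n k * weighted_count 1 n (n - k))"
    using arg_cong[OF weighted_count_deriv[of n], of "\<lambda>f. fps_nth f n"]
    by (simp add: fps_X_deriv_nth fps_mult_nth[of "Abs_fps _"] del: fps_X_mult_nth)
  also have "\<dots> = (\<Sum>k=1..n. divisor_sum_upto n k * weighted_count 1 n (n - k))"
    by (simp add: sum.atLeast_Suc_atMost divisor_sum_upto_def)
  also have "\<dots> = (\<Sum>k=1..n. divisor_sum k * partitions (n - k))"
  proof (rule sum.cong)
    fix k assume k: "k \<in> {1..n}"
    then have "{d. d dvd k \<and> d \<le> n} = {d. d dvd k}"
      using dvd_imp_le[of _ k] by fastforce
    then show "divisor_sum_upto n k * weighted_count 1 n (n - k) = divisor_sum k * partitions (n - k)"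
      using k by (simp add: divisor_sum_upto_def divisor_sum_def weighted_count_ge)
  qed simp
  finally show ?thesis by (simp add: partitions_def)
qed

section \<open>Bounds on divisor sums\<close>

lemma divisor_sum_nonneg: "0 \<le> divisor_sum k"
  by (simp add: divisor_sum_def sum_nonneg)

lemma divisor_sum_ge: "0 < k \<Longrightarrow> int k \<le> divisor_sum k"
  unfolding divisor_sum_def by (rule member_le_sum) (auto simp: finite_divisors_nat)

text \<open>After exchanging the sums, each d \<le> n has at most n/d multiples up to n, so it
  contributes at most n.\<close>

lemma sum_divisor_sum_le: "(\<Sum>k=1..n. divisor_sum k) \<le> int n ^ 2"
proof -
  have "(\<Sum>k=1..n. divisor_sum k) = (\<Sum>k=1..n. \<Sum>d=1..n. if d dvd k then int d else 0)"
  proof (rule sum.cong)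
    fix k assume k: "k \<in> {1..n}"
    have "{d. d dvd k} = {d \<in> {1..n}. d dvd k}"
    proof (intro equalityI subsetI)
      fix d assume "d \<in> {d. d dvd k}"
      then show "d \<in> {d \<in> {1..n}. d dvd k}"
        using k dvd_imp_le[of d k] by (cases "d = 0") auto
    qed simp
    then show "divisor_sum k = (\<Sum>d=1..n. if d dvd k then int d else 0)"
      by (simp only: divisor_sum_def sum.inter_filter[OF finite_atLeastAtMost])
  qed simp
  also have "\<dots> = (\<Sum>d=1..n. \<Sum>k=1..n. if d dvd k then int d else 0)"
    by (rule sum.swap)
  also have "\<dots> \<le> (\<Sum>d=1..n. int n)"
  proof (rule sum_mono)
    fix d assume d: "d \<in> {1..n}"
    have "{k \<in> {1..n}. d dvd k} \<subseteq> (\<lambda>i. d * i) ` {1..n div d}"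
    proof
      fix k assume "k \<in> {k \<in> {1..n}. d dvd k}"
      then obtain i where "k = d * i" "1 \<le> k" "k \<le> n" by (auto elim: dvdE)
      then show "k \<in> (\<lambda>i. d * i) ` {1..n div d}"
        using d by (intro image_eqI[of _ _ i]) (cases i; simp add: less_eq_div_iff_mult_less_eq mult.commute)+
    qed
    then have "card {k \<in> {1..n}. d dvd k} \<le> n div d"
      using surj_card_le[of "{1..n div d}"] by simp
    then have "card {k \<in> {1..n}. d dvd k} * d \<le> n"
      using times_div_less_eq_dividend[of d n] by (metis le_trans mult.commute mult_le_mono1)
    then have "int (card {k \<in> {1..n}. d dvd k} * d) \<le> int n"
      by (simp only: of_nat_le_iff)
    then show "(\<Sum>k=1..n. if d dvd k then int d else 0) \<le> int n"
      unfolding sum.inter_filter[OF finite_atLeastAtMost, symmetric] by simp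
  qed
  finally show ?thesis by (simp add: power2_eq_square)
qed

lemma sum_divisor_sum_le':
  assumes "1 \<le> l" shows "(\<Sum>k=l..n. divisor_sum k) \<le> int n ^ 2"
proof -
  have "(\<Sum>k=l..n. divisor_sum k) \<le> (\<Sum>k=1..n. divisor_sum k)"
    using assms by (intro sum_mono2) (auto simp: divisor_sum_nonneg)
  then show ?thesis using sum_divisor_sum_le[of n] by linarith
qed

section \<open>Monotonicity of the partition function\<close>

lemma partitions_nonneg: "0 \<le> partitions n"
  by (simp add: partitions_def weighted_count_nonneg)

text \<open>Parts 1 must be allowed, hence the bound \<open>Suc m\<close>: for bound 0 the count
  drops from 1 to 0. The recursion lifts the constant case of bound 1.\<close>

lemma weighted_count_mono_Suc: "weighted_count 1 (Suc m) n \<le> weighted_count 1 (Suc m) (Suc n)"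
proof (induction m arbitrary: n)
  case 0
  show ?case by (simp add: weighted_count_1)
next
  case (Suc m)
  show ?case
  proof (induction n rule: less_induct)
    case (less n)
    have "weighted_count 1 (Suc (Suc m)) (n - Suc (Suc m)) \<le>
        weighted_count 1 (Suc (Suc m)) (Suc n - Suc (Suc m))" if "Suc (Suc m) \<le> n"
      using less[of "n - Suc (Suc m)"] Suc_diff_le[OF that] by (simp del: diff_Suc_Suc)
    with Suc[of n] weighted_count_nonneg show ?case
      by (subst (1 2) weighted_count_Suc) (auto intro: add_mono add_increasing2)
  qed
qed

lemma partitions_mono:
  assumes "k \<le> n" shows "partitions k \<le> partitions n"
proof -
  have "partitions n \<le> partitions (Suc n)" for n
    using weighted_count_mono_Suc[of n n] by (simp add: weighted_count_ge)
  then show ?thesis using assms by (rule lift_Suc_mono_le)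
qed


section \<open>Tables of small values\<close>

text \<open>The list functions used for the tables are first-order recursions without \<open>let\<close> and \<open>case\<close>: otherwise
  the simplifier traverses lists that are already evaluated again at each step, which makes the
  evaluation an order of magnitude slower.\<close>

fun add_lists :: "int \<Rightarrow> int list \<Rightarrow> int list \<Rightarrow> int list" where
  "add_lists e (x # xs) (y # ys) = (x + e * y) # add_lists e xs ys"
| "add_lists e (x # xs) [] = []"
| "add_lists e [] ys = []"

lemma add_lists_conv_map2: "add_lists e xs ys = map2 (\<lambda>x y. x + e * y) xs ys"
  by (induction e xs ys rule: add_lists.induct) simp_all

fun take_rec :: "nat \<Rightarrow> int list \<Rightarrow> int list" where
  "take_rec 0 xs = []"
| "take_rec (Suc n) [] = []"
| "take_rec (Suc n) (x # xs) = x # take_rec n xs"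

lemma take_rec_eq: "take_rec n xs = take n xs"
  by (induction n xs rule: take_rec.induct) simp_all

fun drop_rec :: "nat \<Rightarrow> int list \<Rightarrow> int list" where
  "drop_rec 0 xs = xs"
| "drop_rec (Suc n) [] = []"
| "drop_rec (Suc n) (x # xs) = drop_rec n xs"

lemma drop_rec_eq [termination_simp]: "drop_rec n xs = drop n xs"
  by (induction n xs rule: drop_rec.induct) simp_all

text \<open>Solves g n = f n + e g(n - m) in blocks: \<open>ys\<close> is the last block of g and
  the third argument holds the remaining f. Each round emits \<open>ys\<close> and computes the next
  block; one entry less is dropped because \<open>x\<close> is already split off.\<close>

fun add_shifted :: "int \<Rightarrow> int list \<Rightarrow> int list \<Rightarrow> int list" where
  "add_shifted e ys [] = ys"
| "add_shifted e ys (x # xs) =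
    ys @ add_shifted e (add_lists e (x # xs) ys) (drop_rec (length ys - 1) xs)"

lemma add_shifted_correct:
  assumes "0 < m" "m \<le> i" "i \<le> l" and rec: "\<And>n. m \<le> n \<Longrightarrow> g n = f n + e * g (n - m)"
  shows "add_shifted e (map g [i - m..<i]) (map f [i..<l]) = map g [i - m..<l]"
  using \<open>m \<le> i\<close> \<open>i \<le> l\<close>
proof (induction "l - i" arbitrary: i rule: less_induct)
  case less
  show ?case
  proof (cases "i < l")
    case False
    then show ?thesis using less.prems by simp
  next
    case True
    \<comment> \<open>The last block may be shorter than m, hence the minimum.\<close>
    have ys: "add_lists e (map f [i..<l]) (map g [i - m..<i]) = map g [i..<min l (i + m)]"
      (is "?l = ?r")
    proof (rule nth_equalityI)
      fix k assume "k < length ?l"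
      then have "k < l - i" "k < m" by (auto simp: add_lists_conv_map2)
      then show "?l ! k = ?r ! k" using \<open>m \<le> i\<close> by (simp add: rec[of "i + k"] add_lists_conv_map2)
    qed (use \<open>m \<le> i\<close> in \<open>auto simp: add_lists_conv_map2\<close>)
    have "[i..<l] = i # [Suc i..<l]" using True by (rule upt_conv_Cons)
    then have "map f [i..<l] = f i # map f [Suc i..<l]" by simp
    moreover have "drop (m - 1) (map f [Suc i..<l]) = map f [i + m..<l]"
      using \<open>0 < m\<close> by (simp add: drop_map)
    ultimately have "add_shifted e (map g [i - m..<i]) (map f [i..<l]) =
        map g [i - m..<i] @ add_shifted e (map g [i..<min l (i + m)]) (map f [i + m..<l])"
      using ys \<open>m \<le> i\<close> by (simp add: drop_rec_eq)
    also have "add_shifted e (map g [i..<min l (i + m)]) (map f [i + m..<l]) = map g [i..<l]"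
    proof (cases "i + m < l")
      case False
      then show ?thesis by (simp add: min_def)
    next
      case small: True
      then have "add_shifted e (map g [i + m - m..<i + m]) (map f [i + m..<l]) = map g [i + m - m..<l]"
        using \<open>0 < m\<close> by (intro less.hyps) auto
      then show ?thesis using small by (simp add: min_def)
    qed
    also have "map g [i - m..<i] @ map g [i..<l] = map g [i - m..<l]"
      using True by (metis diff_le_self le_add_diff_inverse less_imp_le map_append upt_add_eq_append)
    finally show ?thesis .
  qed
qed

text \<open>The first m entries are unchanged, as a part m does not fit there; they form the initial
  block.\<close>

definition next_row :: "int \<Rightarrow> nat \<Rightarrow> int list \<Rightarrow> int list" where
  "next_row e m xs = add_shifted e (take_rec m xs) (drop_rec m xs)"

lemma next_row_correct:
  "next_row e (Suc m) (map (weighted_count e m) [0..<l]) = map (weighted_count e (Suc m)) [0..<l]"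
proof (cases "Suc m \<le> l")
  case True
  have "take (Suc m) (map (weighted_count e m) [0..<l]) =
      map (weighted_count e (Suc m)) [Suc m - Suc m..<Suc m]"
    using True by (auto simp: take_map weighted_count_Suc[of e m] simp del: upt_Suc)
  moreover have "add_shifted e (map (weighted_count e (Suc m)) [Suc m - Suc m..<Suc m])
      (map (weighted_count e m) [Suc m..<l]) = map (weighted_count e (Suc m)) [Suc m - Suc m..<l]"
    using True by (intro add_shifted_correct) (auto simp: weighted_count_Suc[of e m])
  ultimately show ?thesis
    by (simp add: next_row_def take_rec_eq drop_rec_eq drop_map del: upt_Suc)
next
  case False
  then show ?thesis
    by (auto simp: next_row_def take_rec_eq drop_rec_eq weighted_count_Suc[of e m])
qed

primrec weighted_row :: "int \<Rightarrow> nat \<Rightarrow> nat \<Rightarrow> int list" where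
  "weighted_row e l 0 = 1 # replicate l 0"
| "weighted_row e l (Suc m) = next_row e (Suc m) (weighted_row e l m)"

lemma weighted_row_correct: "weighted_row e l m = map (weighted_count e m) [0..<Suc l]"
proof (induction m)
  case 0
  have "map (weighted_count e 0) [0..<Suc l] = weighted_count e 0 0 # map (weighted_count e 0) [1..<Suc l]"
    by (simp add: upt_conv_Cons del: upt_Suc)
  also have "map (weighted_count e 0) [1..<Suc l] = replicate l 0"
    by (rule nth_equalityI) (auto simp: weighted_count_0 simp del: upt_Suc)
  finally show ?case by (simp add: weighted_count_0)
qed (simp only: weighted_row.simps next_row_correct)

text \<open>\<open>ws\<close> is already the row for bound \<open>Suc m\<close>. Since
  \<open>ss\<close> starts at n = 1, dropping m entries aligns n = \<open>Suc m\<close> with index 0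
  of \<open>ws\<close>.\<close>

definition next_signed_rows :: "nat \<Rightarrow> int list \<Rightarrow> int list \<Rightarrow> int list \<times> int list" where
  "next_signed_rows m ws ss = (ws, take_rec m ss @ add_lists ((-1) ^ m) (drop_rec m ss) ws)"

primrec signed_rows :: "nat \<Rightarrow> nat \<Rightarrow> int list \<times> int list" where
  "signed_rows l 0 = (1 # replicate l 0, replicate l 0)"
| "signed_rows l (Suc m) = (case signed_rows l m of (ws, ss) \<Rightarrow>
    next_signed_rows m (next_row (-1) (Suc m) ws) ss)"

lemma signed_rows_correct:
  "signed_rows l m = (map (weighted_count (-1) m) [0..<Suc l], map (signed_count m) [1..<Suc l])"
proof (induction m)
  case 0
  have "replicate l 0 = map (signed_count 0) [1..<Suc l]"
    by (rule nth_equalityI) (auto simp: signed_count_0 simp del: upt_Suc)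
  then show ?case
    using weighted_row_correct[of "-1" l 0] by simp
next
  case (Suc m)
  have "take m (map (signed_count m) [1..<Suc l]) @ add_lists ((-1) ^ m)
      (drop m (map (signed_count m) [1..<Suc l])) (map (weighted_count (-1) (Suc m)) [0..<Suc l]) =
      map (signed_count (Suc m)) [1..<Suc l]"
    by (rule nth_equalityI)
      (auto simp: nth_append add_lists_conv_map2 signed_count_Suc[of m] simp del: upt_Suc)
  then show ?case
    by (simp only: signed_rows.simps Suc.IH next_row_correct prod.case next_signed_rows_def
        take_rec_eq drop_rec_eq)
qed

lemma map_partitions: "map partitions [0..<Suc l] = weighted_row 1 l l"
  unfolding weighted_row_correct
  by (rule map_cong) (auto simp: weighted_count_ge simp del: upt_Suc)

lemma map_rank_excess: "map rank_excess [1..<Suc l] = snd (signed_rows l l)"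
  unfolding signed_rows_correct snd_conv
  by (rule map_cong) (auto simp: signed_count_ge simp del: upt_Suc)

text \<open>The values for n \<le> 161, the starting range of \<open>partition_growth\<close>; the
  product checks use sums up to 160.\<close>

definition partition_table :: "int list" where
  "partition_table =
    [1, 1, 2, 3, 5, 7, 11, 15, 22, 30, 42, 56, 77, 101, 135, 176, 231, 297, 385, 490, 627,
     792, 1002, 1255, 1575, 1958, 2436, 3010, 3718, 4565, 5604, 6842, 8349, 10143, 12310,
     14883, 17977, 21637, 26015, 31185, 37338, 44583, 53174, 63261, 75175, 89134, 105558,
     124754, 147273, 173525, 204226, 239943, 281589, 329931, 386155, 451276, 526823, 614154,
     715220, 831820, 966467, 1121505, 1300156, 1505499, 1741630, 2012558, 2323520, 2679689,
     3087735, 3554345, 4087968, 4697205, 5392783, 6185689, 7089500, 8118264, 9289091,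
     10619863, 12132164, 13848650, 15796476, 18004327, 20506255, 23338469, 26543660, 30167357,
     34262962, 38887673, 44108109, 49995925, 56634173, 64112359, 72533807, 82010177, 92669720,
     104651419, 118114304, 133230930, 150198136, 169229875, 190569292, 214481126, 241265379,
     271248950, 304801365, 342325709, 384276336, 431149389, 483502844, 541946240, 607163746,
     679903203, 761002156, 851376628, 952050665, 1064144451, 1188908248, 1327710076,
     1482074143, 1653668665, 1844349560, 2056148051, 2291320912, 2552338241, 2841940500,
     3163127352, 3519222692, 3913864295, 4351078600, 4835271870, 5371315400, 5964539504,
     6620830889, 7346629512, 8149040695, 9035836076, 10015581680, 11097645016, 12292341831,
     13610949895, 15065878135, 16670689208, 18440293320, 20390982757, 22540654445,
     24908858009, 27517052599, 30388671978, 33549419497, 37027355200, 40853235313,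
     45060624582, 49686288421, 54770336324, 60356673280, 66493182097, 73232243759,
     80630964769, 88751778802, 97662728555, 107438159466, 118159068427]"

text \<open>The entries below start at \<open>n = 1\<close>, those of \<^const>\<open>partition_table\<close> at \<open>n = 0\<close>.\<close>
definition rank_excess_table :: "int list" where
  "rank_excess_table =
    [1, -2, 3, -3, 3, -5, 7, -6, 6, -10, 12, -11, 13, -17, 20, -21, 21, -27, 34, -33, 36, -46,
     51, -53, 58, -68, 78, -82, 89, -104, 118, -123, 131, -154, 171, -179, 197, -221, 245,
     -262, 279, -314, 349, -369, 398, -446, 486, -515, 557, -614, 671, -715, 767, -845, 920,
     -977, 1046, -1148, 1244, -1321]"

lemma weighted_row_161: "weighted_row 1 161 161 = partition_table"
  by code_simp

lemma signed_rows_60: "snd (signed_rows 60 60) = rank_excess_table"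
  by code_simp

section \<open>Checking inequalities on the tables\<close>

fun products_gt :: "int \<Rightarrow> int \<Rightarrow> int list \<Rightarrow> int list \<Rightarrow> bool" where
  "products_gt c x (y # ys) (z # zs) \<longleftrightarrow> c * z < x * y \<and> products_gt c x ys zs"
| "products_gt c x ys zs \<longleftrightarrow> True"

text \<open>\<open>zs\<close> loses one entry for each entry of \<open>xs\<close>, so entry i of
  \<open>xs\<close> and entry j of \<open>ys\<close> meet entry i + j of \<open>zs\<close>.\<close>

fun all_products_gt :: "int \<Rightarrow> int list \<Rightarrow> int list \<Rightarrow> int list \<Rightarrow> bool" where
  "all_products_gt c (x # xs) ys (z # zs) \<longleftrightarrow>
     products_gt c x ys (z # zs) \<and> all_products_gt c xs ys zs"
| "all_products_gt c xs ys zs \<longleftrightarrow> True"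

lemma products_gtD:
  "products_gt c x ys zs \<Longrightarrow> j < length ys \<Longrightarrow> j < length zs \<Longrightarrow> c * zs ! j < x * ys ! j"
proof (induction c x ys zs arbitrary: j rule: products_gt.induct)
  case (1 c x y ys z zs)
  then show ?case by (cases j) auto
qed auto

lemma all_products_gtD:
  "all_products_gt c xs ys zs \<Longrightarrow> i < length xs \<Longrightarrow> j < length ys \<Longrightarrow> i + j < length zs \<Longrightarrow>
     c * zs ! (i + j) < xs ! i * ys ! j"
proof (induction c xs ys zs arbitrary: i rule: all_products_gt.induct)
  case (1 c x xs ys z zs)
  then show ?case
    using products_gtD[of c x ys "z # zs" j] by (cases i) auto
qed auto

lemma all_products_gt_mapD:
  assumes "all_products_gt c (map f [a\<^sub>0..<a\<^sub>1]) (map f [b\<^sub>0..<b\<^sub>1]) (map f [a\<^sub>0 + b\<^sub>0..<l])"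
    and "a\<^sub>0 \<le> a" "a < a\<^sub>1" "b\<^sub>0 \<le> b" "b < b\<^sub>1" "a + b < l"
  shows "c * f (a + b) < f a * f b"
  using all_products_gtD[OF assms(1), of "a - a\<^sub>0" "b - b\<^sub>0"] assms(2-)
  by (simp add: algebra_simps)

lemma list_all2_mapD:
  assumes "list_all2 P (map f [l..<u]) (map g [k..<v])" "l \<le> n" "n < u"
  shows "P (f n) (g (k + (n - l)))"
  using list_all2_nthD[OF assms(1), of "n - l"] list_all2_lengthD[OF assms(1)] assms(2,3) by simp

lemma partition_table_eq: "map partitions [0..<162] = partition_table"
  using map_partitions[of 161] weighted_row_161 by simp

lemma rank_excess_table_eq: "map rank_excess [1..<61] = rank_excess_table"
  using map_rank_excess[of 60] signed_rows_60 by simp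

lemma partition_products_small:
  assumes "11 \<le> a" "a < 81" "31 \<le> b" "b < 81"
  shows "7 * partitions (a + b) < partitions a * partitions b"
proof -
  let ?T = partition_table
  have "all_products_gt 7 (take_rec 70 (drop_rec 11 ?T)) (take_rec 50 (drop_rec 31 ?T)) (drop_rec 42 ?T)"
    by code_simp
  then have "all_products_gt 7 (map partitions [11..<81]) (map partitions [31..<81])
      (map partitions [11 + 31..<162])"
    by (simp add: take_rec_eq drop_rec_eq take_map drop_map flip: partition_table_eq
        del: upt_rec_numeral)
  from all_products_gt_mapD[OF this] show ?thesis using assms by (simp del: upt_rec_numeral)
qed

text \<open>The bound fails at n = 80, hence the start at 81.\<close>

lemma partition_growth_small:
  assumes "81 \<le> n" "n < 162"
  shows "2000 * (int n + 11)\<^sup>2 \<le> partitions n"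
proof -
  have "list_all2 (\<lambda>n x. 2000 * (n + 11)\<^sup>2 \<le> x) (map int [81..<162]) (drop_rec 81 partition_table)"
    by code_simp
  then have "list_all2 (\<lambda>n x. 2000 * (n + 11)\<^sup>2 \<le> x) (map int [81..<162]) (map partitions [81..<162])"
    by (simp add: drop_rec_eq drop_map flip: partition_table_eq del: upt_rec_numeral)
  from list_all2_mapD[OF this assms] show ?thesis using assms by (simp del: upt_rec_numeral)
qed

text \<open>The inequality fails at n = 30. The range ends at 83 = 81 + 2 because growth is later
  applied at n - 2.\<close>

lemma partition_ratio_small:
  assumes "31 \<le> n" "n < 83"
  shows "2 * partitions n + 3 \<le> 3 * partitions (n - 2)"
proof -
  let ?T = partition_table
  have "list_all2 (\<lambda>x y. 2 * x + 3 \<le> 3 * y)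
      (take_rec 52 (drop_rec 31 ?T)) (take_rec 52 (drop_rec 29 ?T))"
    by code_simp
  then have "list_all2 (\<lambda>x y. 2 * x + 3 \<le> 3 * y)
      (map partitions [31..<83]) (map partitions [29..<81])"
    by (simp add: take_rec_eq drop_rec_eq take_map drop_map flip: partition_table_eq
        del: upt_rec_numeral)
  moreover have "29 + (n - 31) = n - 2" using assms by simp
  ultimately show ?thesis using list_all2_mapD[of _ _ 31 83 _ 29 81 n] assms by metis
qed

text \<open>Twice N(0,2;n) for s = 1 and twice N(1,2;n) for s = -1, which explains the factor 2 in
  the product inequalities.\<close>

definition signed_rank_count :: "int \<Rightarrow> nat \<Rightarrow> int" where
  "signed_rank_count s n = partitions n + s * rank_excess n"

definition signed_rank_table :: "int \<Rightarrow> int list" where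
  "signed_rank_table s = add_lists s (take_rec 60 (drop_rec 1 partition_table)) rank_excess_table"

lemma signed_rank_table_eq: "signed_rank_table s = map (signed_rank_count s) [1..<61]"
  unfolding signed_rank_table_def partition_table_eq[symmetric] rank_excess_table_eq[symmetric]
  by (simp add: add_lists_conv_map2 take_rec_eq drop_rec_eq take_map drop_map zip_map_map
      zip_same_conv_map signed_rank_count_def del: upt_rec_numeral)

lemma even_rank_products_small:
  assumes "11 \<le> a" "a < 31" "11 \<le> b" "b < 31"
  shows "2 * signed_rank_count 1 (a + b) < signed_rank_count 1 a * signed_rank_count 1 b"
proof -
  let ?E = "signed_rank_table 1"
  \<comment> \<open>The table starts at n = 1, so dropping 10 and 21 entries leads to n = 11 and n =
    22.\<close>
  have "all_products_gt 2 (take_rec 20 (drop_rec 10 ?E)) (take_rec 20 (drop_rec 10 ?E)) (drop_rec 21 ?E)"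
    by code_simp
  then have "all_products_gt 2 (map (signed_rank_count 1) [11..<31]) (map (signed_rank_count 1) [11..<31])
      (map (signed_rank_count 1) [11 + 11..<61])"
    by (simp add: signed_rank_table_eq take_rec_eq drop_rec_eq take_map drop_map del: upt_rec_numeral)
  from all_products_gt_mapD[OF this] show ?thesis using assms by (simp del: upt_rec_numeral)
qed

text \<open>At a = b = 11 the odd class fails, since 22 * 22 < 524.\<close>

lemma odd_rank_products_small:
  assumes "12 \<le> a" "a < 31" "12 \<le> b" "b < 31"
  shows "2 * signed_rank_count (-1) (a + b) < signed_rank_count (-1) a * signed_rank_count (-1) b"
proof -
  let ?E = "signed_rank_table (-1)"
  have "all_products_gt 2 (take_rec 19 (drop_rec 11 ?E)) (take_rec 19 (drop_rec 11 ?E)) (drop_rec 23 ?E)"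
    by code_simp
  then have "all_products_gt 2 (map (signed_rank_count (-1)) [12..<31])
      (map (signed_rank_count (-1)) [12..<31]) (map (signed_rank_count (-1)) [12 + 12..<61])"
    by (simp add: signed_rank_table_eq take_rec_eq drop_rec_eq take_map drop_map del: upt_rec_numeral)
  from all_products_gt_mapD[OF this] show ?thesis using assms by (simp del: upt_rec_numeral)
qed

text \<open>Supplies the factor 4/7 needed in \<open>signed_rank_count_products\<close> when a is
  below the range of \<open>signed_rank_count_bounds\<close>.\<close>

lemma even_rank_share_small:
  assumes "11 \<le> a" "a < 31"
  shows "4 * partitions a < 7 * signed_rank_count 1 a"
proof -
  have "list_all2 (\<lambda>x y. 4 * x < 7 * y) (take_rec 20 (drop_rec 11 partition_table))
      (take_rec 20 (drop_rec 10 (signed_rank_table 1)))"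
    by code_simp
  then have "list_all2 (\<lambda>x y. 4 * x < 7 * y) (map partitions [11..<31])
      (map (signed_rank_count 1) [11..<31])"
    by (simp add: signed_rank_table_eq take_rec_eq drop_rec_eq take_map drop_map
        flip: partition_table_eq del: upt_rec_numeral)
  from list_all2_mapD[OF this assms] show ?thesis using assms by (simp del: upt_rec_numeral)
qed

lemma odd_rank_share_small:
  assumes "12 \<le> a" "a < 31"
  shows "4 * partitions a < 7 * signed_rank_count (-1) a"
proof -
  have "list_all2 (\<lambda>x y. 4 * x < 7 * y) (take_rec 19 (drop_rec 12 partition_table))
      (take_rec 19 (drop_rec 11 (signed_rank_table (-1))))"
    by code_simp
  then have "list_all2 (\<lambda>x y. 4 * x < 7 * y) (map partitions [12..<31])
      (map (signed_rank_count (-1)) [12..<31])"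
    by (simp add: signed_rank_table_eq take_rec_eq drop_rec_eq take_map drop_map
        flip: partition_table_eq del: upt_rec_numeral)
  from list_all2_mapD[OF this assms] show ?thesis using assms by (simp del: upt_rec_numeral)
qed

section \<open>Growth of the partition function\<close>

text \<open>For k \<le> n/2 the induction hypothesis at n - k loses at most a factor 4. Since
  \<sigma>(k) \<ge> k, the weights in Euler's recurrence sum to at least 4n, which regains
  it.\<close>

lemma partition_growth: "81 \<le> n \<Longrightarrow> 2000 * (int n + 11)\<^sup>2 \<le> partitions n"
proof (induction n rule: less_induct)
  case (less n)
  show ?case
  proof (cases "n < 162")
    case True
    then show ?thesis using less.prems by (intro partition_growth_small)
  next
    case False
    define h where "h = n div 2"
    have quarter: "500 * (int n + 11)\<^sup>2 \<le> partitions (n - k)" if k: "k \<in> {1..h}" for k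
    proof -
      have le: "k \<le> n" "n \<le> 2 * (n - k)" using k by (auto simp: h_def)
      then have "int n + 11 \<le> 2 * (int (n - k) + 11)" by (simp add: of_nat_diff)
      then have "(int n + 11)\<^sup>2 \<le> (2 * (int (n - k) + 11))\<^sup>2" by (intro power_mono) auto
      moreover have "2000 * (int (n - k) + 11)\<^sup>2 \<le> partitions (n - k)"
        using k le False by (intro less.IH) auto
      moreover have "(2 * (int (n - k) + 11))\<^sup>2 = 4 * (int (n - k) + 11)\<^sup>2"
        by (simp only: power_mult_distrib) simp
      ultimately show ?thesis by linarith
    qed
    have sum_h: "2 * (\<Sum>k=1..h. int k) = int h * (int h + 1)"
      by (induction h) (auto simp: algebra_simps)
    have "n \<le> 2 * h + 1" "81 \<le> h" using False by (auto simp: h_def)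
    then have "8 * int n \<le> int h * (int h + 1)"
      using mult_right_mono[of 81 "int h" "int h + 1"] by simp
    then have "4 * int n \<le> (\<Sum>k=1..h. int k)" using sum_h by simp
    then have "int n * (2000 * (int n + 11)\<^sup>2) \<le> (\<Sum>k=1..h. int k) * (500 * (int n + 11)\<^sup>2)"
      using mult_right_mono[of "4 * int n" _ "500 * (int n + 11)\<^sup>2"] by simp
    also have "\<dots> = (\<Sum>k=1..h. int k * (500 * (int n + 11)\<^sup>2))"
      by (rule sum_distrib_right)
    also have "\<dots> \<le> (\<Sum>k=1..h. divisor_sum k * partitions (n - k))"
      by (intro sum_mono mult_mono divisor_sum_ge quarter) (auto simp: divisor_sum_nonneg)
    also have "\<dots> \<le> (\<Sum>k=1..n. divisor_sum k * partitions (n - k))"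
      by (rule sum_mono2) (auto simp: h_def divisor_sum_nonneg partitions_nonneg)
    also have "\<dots> = int n * partitions n"
      by (rule euler_recurrence[symmetric])
    finally show ?thesis using False by (simp only: mult_le_cancel_left_pos of_nat_0_less_iff)
  qed
qed

text \<open>Isolates the terms with n - k < c, which an induction hypothesis valid from c onwards
  does not reach.\<close>

lemma euler_recurrence_split:
  assumes "c < n"
  shows "int n * partitions n \<le>
    (\<Sum>k=1..n - c. divisor_sum k * partitions (n - k)) + (int n)\<^sup>2 * partitions (c - 1)"
proof -
  have "{1..n} = {1..n - c} \<union> {n - c + 1..n}" using assms by auto
  then have "(\<Sum>k=1..n. divisor_sum k * partitions (n - k)) =
      (\<Sum>k=1..n - c. divisor_sum k * partitions (n - k)) +
      (\<Sum>k=n - c + 1..n. divisor_sum k * partitions (n - k))"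
    by (simp add: sum.union_disjoint)
  also have "(\<Sum>k=n - c + 1..n. divisor_sum k * partitions (n - k)) \<le>
      (\<Sum>k=n - c + 1..n. divisor_sum k * partitions (c - 1))"
    by (intro sum_mono mult_left_mono partitions_mono divisor_sum_nonneg) auto
  also have "\<dots> = (\<Sum>k=n - c + 1..n. divisor_sum k) * partitions (c - 1)"
    by (rule sum_distrib_right[symmetric])
  also have "\<dots> \<le> (int n)\<^sup>2 * partitions (c - 1)"
    by (intro mult_right_mono sum_divisor_sum_le' partitions_nonneg) simp
  finally show ?thesis by (simp add: euler_recurrence)
qed

lemma partitions_30: "partitions 30 = 5604" and partitions_31: "partitions 31 = 6842"
proof -
  have "map partitions [0..<162] ! n = partition_table ! n" for n
    by (simp only: partition_table_eq)
  from this[of 30] this[of 31] show "partitions 30 = 5604" "partitions 31 = 6842"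
    by (simp_all add: partition_table_def del: upt_rec_numeral)
qed

text \<open>The +3 absorbs the +1 of \<open>abs_rank_excess_le\<close>. Applying the hypothesis
  termwise yields 3(n - 2)p(n - 2); the missing 6p(n - 2) dominates the quadratic boundary term by
  growth.\<close>

lemma partition_ratio: "31 \<le> n \<Longrightarrow> 2 * partitions n + 3 \<le> 3 * partitions (n - 2)"
proof (induction n rule: less_induct)
  case (less n)
  show ?case
  proof (cases "n < 83")
    case True
    then show ?thesis using less.prems by (intro partition_ratio_small)
  next
    case False
    let ?A = "\<Sum>k=1..n - 31. divisor_sum k * partitions (n - k)"
    have "2 * ?A = (\<Sum>k=1..n - 31. divisor_sum k * (2 * partitions (n - k)))"
      by (simp add: sum_distrib_left mult.left_commute)
    also have "\<dots> \<le> (\<Sum>k=1..n - 31. divisor_sum k * (3 * partitions (n - 2 - k)))"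
    proof (intro sum_mono mult_left_mono divisor_sum_nonneg)
      fix k assume k: "k \<in> {1..n - 31}"
      then have "2 * partitions (n - k) + 3 \<le> 3 * partitions (n - k - 2)"
        by (intro less.IH) auto
      then show "2 * partitions (n - k) \<le> 3 * partitions (n - 2 - k)"
        by (simp add: diff_right_commute)
    qed
    also have "\<dots> = 3 * (\<Sum>k=1..n - 31. divisor_sum k * partitions (n - 2 - k))"
      by (simp add: sum_distrib_left mult.left_commute)
    also have "\<dots> \<le> 3 * (\<Sum>k=1..n - 2. divisor_sum k * partitions (n - 2 - k))"
      by (intro mult_left_mono sum_mono2) (auto simp: divisor_sum_nonneg partitions_nonneg)
    also have "\<dots> = 3 * (int (n - 2) * partitions (n - 2))"
      by (simp only: euler_recurrence)
    finally have A: "2 * ?A \<le> 3 * (int (n - 2) * partitions (n - 2))" .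
    have n2: "int (n - 2) = int n - 2" using False by simp
    have "int n * partitions n \<le> ?A + (int n)\<^sup>2 * 5604"
      using euler_recurrence_split[of 31 n] False partitions_30 by simp
    moreover have "2000 * (int n + 9)\<^sup>2 \<le> partitions (n - 2)"
      using partition_growth[of "n - 2"] False n2 by (simp add: add.commute)
    \<comment> \<open>11208 is 2 * 5604, twice p(30) from the boundary term.\<close>
    moreover have "3 * int n + 11208 * (int n)\<^sup>2 \<le> 6 * (2000 * (int n + 9)\<^sup>2)"
      by (simp add: power2_eq_square algebra_simps)
    ultimately have "2 * (int n * partitions n) + 3 * int n \<le>
        3 * ((int n - 2) * partitions (n - 2)) + 6 * partitions (n - 2)"
      using A n2 by simp
    then have "int n * (2 * partitions n + 3) \<le> int n * (3 * partitions (n - 2))"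
      by (simp add: algebra_simps)
    then show ?thesis using False by (simp only: mult_le_cancel_left_pos of_nat_0_less_iff)
  qed
qed

text \<open>The difference of the two sides factors as (a - 11)(b^2 - 11a).\<close>

lemma quadratic_le:
  fixes a b :: int
  assumes "11 \<le> a" "a \<le> b"
  shows "11 * (a + b)\<^sup>2 \<le> a * (b + 11)\<^sup>2"
proof -
  have "11 * a \<le> b * b" using assms by (intro mult_mono) auto
  then have "0 \<le> (a - 11) * (b * b - 11 * a)" using assms by simp
  then show ?thesis by (simp add: power2_eq_square algebra_simps)
qed

text \<open>Euler's recurrence at a + b with a fixed: terms k \<le> b - 31 sum to at most b
  p(a)p(b), and growth of p(b) bounds the boundary by a p(a)p(b). Together they give the factor a +
  b.\<close>

lemma partition_products:
  "11 \<le> a \<Longrightarrow> 31 \<le> b \<Longrightarrow> 7 * partitions (a + b) \<le> partitions a * partitions b"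
proof (induction "a + b" arbitrary: a b rule: less_induct)
  case less
  \<comment> \<open>The hypothesis depends only on the sum a + b, so it survives exchanging a and
    b.\<close>
  have ordered: "7 * partitions (a + b) \<le> partitions a * partitions b"
    if ab: "11 \<le> a" "a \<le> b" "31 \<le> b"
      and IH: "\<And>a' b'. a' + b' < a + b \<Longrightarrow> 11 \<le> a' \<Longrightarrow> 31 \<le> b' \<Longrightarrow>
        7 * partitions (a' + b') \<le> partitions a' * partitions b'" for a b
  proof (cases "b < 81")
    case True
    then show ?thesis using partition_products_small[of a b] ab by simp
  next
    case False
    let ?S = "\<Sum>k=1..b - 31. divisor_sum k * partitions (a + b - k)"
    have "7 * ?S = (\<Sum>k=1..b - 31. divisor_sum k * (7 * partitions (a + (b - k))))"
      unfolding sum_distrib_left by (rule sum.cong) auto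
    also have "\<dots> \<le> (\<Sum>k=1..b - 31. divisor_sum k * (partitions a * partitions (b - k)))"
      using ab by (intro sum_mono mult_left_mono divisor_sum_nonneg IH) auto
    also have "\<dots> = partitions a * (\<Sum>k=1..b - 31. divisor_sum k * partitions (b - k))"
      by (simp add: sum_distrib_left mult.left_commute)
    also have "\<dots> \<le> partitions a * (\<Sum>k=1..b. divisor_sum k * partitions (b - k))"
      by (intro mult_left_mono sum_mono2) (auto simp: divisor_sum_nonneg partitions_nonneg)
    also have "\<dots> = partitions a * (int b * partitions b)"
      by (simp only: euler_recurrence)
    finally have S: "7 * ?S \<le> partitions a * (int b * partitions b)" .
    have shift: "a + b - (a + 31) = b - 31" "a + 31 - 1 = a + 30" by simp_all
    have "a + 31 < a + b" using False by simp
    from euler_recurrence_split[OF this]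
    have split: "int (a + b) * partitions (a + b) \<le>
        ?S + (int (a + b))\<^sup>2 * partitions (a + 30)"
      by (simp only: shift)
    \<comment> \<open>Raising a + 30 to a + 31 makes the induction hypothesis applicable with second
      argument 31.\<close>
    have "7 * partitions (a + 30) \<le> 7 * partitions (a + 31)"
      using partitions_mono[of "a + 30" "a + 31"] by simp
    also have "\<dots> \<le> partitions a * partitions 31"
      using ab False by (intro IH) auto
    finally have "(int (a + b))\<^sup>2 * (7 * partitions (a + 30)) \<le>
        (int (a + b))\<^sup>2 * (partitions a * 6842)"
      unfolding partitions_31 by (rule mult_left_mono) simp
    also have "\<dots> \<le> partitions a * (int a * partitions b)"
    proof -
      \<comment> \<open>6842 is p(31); the following step needs only 6842 \<le> 11 * 2000.\<close>
      have "11 * (6842 * (int (a + b))\<^sup>2) \<le> 6842 * (int a * (int b + 11)\<^sup>2)"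
        using quadratic_le[of "int a" "int b"] ab by simp
      also have "\<dots> \<le> 11 * (int a * (2000 * (int b + 11)\<^sup>2))"
        by simp
      also have "\<dots> \<le> 11 * (int a * partitions b)"
        using partition_growth[of b] False by (intro mult_left_mono) auto
      finally have "(int (a + b))\<^sup>2 * 6842 \<le> int a * partitions b" by simp
      then have "partitions a * ((int (a + b))\<^sup>2 * 6842) \<le> partitions a * (int a * partitions b)"
        by (intro mult_left_mono partitions_nonneg)
      then show ?thesis by (simp only: mult.left_commute mult.commute)
    qed
    finally have "int (a + b) * (7 * partitions (a + b)) \<le>
        partitions a * (int b * partitions b) + partitions a * (int a * partitions b)"
      using S split by simp
    also have "\<dots> = int (a + b) * (partitions a * partitions b)"
      by (simp add: algebra_simps)
    finally show ?thesis
      using ab by (simp only: mult_le_cancel_left_pos of_nat_0_less_iff)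
  qed
  show ?case
  proof (cases "a \<le> b")
    case True
    then show ?thesis using ordered[of a b] less by blast
  next
    case False
    have "7 * partitions (b + a) \<le> partitions b * partitions a"
    proof (rule ordered)
      fix a' b' assume "a' + b' < b + a" "11 \<le> a'" "31 \<le> b'"
      then show "7 * partitions (a' + b') \<le> partitions a' * partitions b'"
        by (intro less.hyps) linarith+
    qed (use False less.prems in linarith)+
    then show ?thesis by (simp add: ac_simps)
  qed
qed

section \<open>Rank parity classes\<close>

text \<open>\<open>partition_ratio\<close> turns the bound on the rank excess into 3|\<alpha>(n)|
  \<le> p(n).\<close>

lemma signed_rank_count_bounds:
  assumes "31 \<le> n" "\<bar>s\<bar> = 1"
  shows "2 * partitions n \<le> 3 * signed_rank_count s n" "3 * signed_rank_count s n \<le> 4 * partitions n"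
proof -
  have "3 * \<bar>s * rank_excess n\<bar> \<le> partitions n"
    using abs_rank_excess_le[of n] partition_ratio[of n] assms by (simp add: abs_mult)
  then show "2 * partitions n \<le> 3 * signed_rank_count s n"
    "3 * signed_rank_count s n \<le> 4 * partitions n"
    by (auto simp: signed_rank_count_def abs_le_iff)
qed

text \<open>The constants match exactly: (4/7)(2/3) * 7 = 8/3 = 2 * (4/3), with 4/3 from the upper
  bound at a + b. Strictness comes from the factor 4/7.\<close>

lemma signed_rank_count_products:
  assumes "11 \<le> a" "31 \<le> b" "\<bar>s\<bar> = 1" and small: "a < 31 \<Longrightarrow> 4 * partitions a < 7 * signed_rank_count s a"
  shows "2 * signed_rank_count s (a + b) < signed_rank_count s a * signed_rank_count s b"
proof -
  have pos: "0 < partitions n" if "31 \<le> n" for n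
    using that partitions_mono[of 31 n] partitions_31 by simp
  have a: "4 * partitions a < 7 * signed_rank_count s a"
  proof (cases "a < 31")
    case False
    then show ?thesis using signed_rank_count_bounds(1)[of a s] pos[of a] assms(3) by simp
  qed (rule small)
  have b: "2 * partitions b \<le> 3 * signed_rank_count s b"
    using assms by (intro signed_rank_count_bounds)
  have "42 * signed_rank_count s (a + b) \<le> 8 * (7 * partitions (a + b))"
    using signed_rank_count_bounds(2)[of "a + b" s] assms by simp
  also have "\<dots> \<le> 8 * (partitions a * partitions b)"
    using partition_products[of a b] assms by simp
  also have "\<dots> = (4 * partitions a) * (2 * partitions b)" by simp
  also have "\<dots> < (7 * signed_rank_count s a) * (2 * partitions b)"
    using a pos[of b] assms by (intro mult_strict_right_mono) auto
  also have "\<dots> \<le> (7 * signed_rank_count s a) * (3 * signed_rank_count s b)"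
    using a b partitions_nonneg[of a] by (intro mult_left_mono) auto
  finally show ?thesis by simp
qed

lemma even_rank_products:
  assumes "11 \<le> a" "11 \<le> b"
  shows "2 * signed_rank_count 1 (a + b) < signed_rank_count 1 a * signed_rank_count 1 b"
proof (cases "a < 31 \<and> b < 31")
  case True
  then show ?thesis using even_rank_products_small assms by blast
next
  case False
  then consider "31 \<le> b" | "31 \<le> a" by linarith
  then show ?thesis
  proof cases
    case 1
    then show ?thesis using assms even_rank_share_small by (intro signed_rank_count_products) auto
  next
    case 2
    then have "2 * signed_rank_count 1 (b + a) < signed_rank_count 1 b * signed_rank_count 1 a"
      using assms even_rank_share_small by (intro signed_rank_count_products) auto
    then show ?thesis by (simp add: ac_simps)
  qed
qed

lemma odd_rank_products:
  assumes "12 \<le> a" "12 \<le> b"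
  shows "2 * signed_rank_count (-1) (a + b) < signed_rank_count (-1) a * signed_rank_count (-1) b"
proof (cases "a < 31 \<and> b < 31")
  case True
  then show ?thesis using odd_rank_products_small assms by blast
next
  case False
  then consider "31 \<le> b" | "31 \<le> a" by linarith
  then show ?thesis
  proof cases
    case 1
    then show ?thesis using assms odd_rank_share_small by (intro signed_rank_count_products) auto
  next
    case 2
    then have "2 * signed_rank_count (-1) (b + a) < signed_rank_count (-1) b * signed_rank_count (-1) a"
      using assms odd_rank_share_small by (intro signed_rank_count_products) auto
    then show ?thesis by (simp add: ac_simps)
  qed
qed

theorem theorem1p3:
  shows "(\<forall>a b :: nat. a \<ge> 11 \<and> b \<ge> 11 \<longrightarrow>
            rank_count 0 2 a * rank_count 0 2 b > rank_count 0 2 (a + b)) \<and>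
         (\<forall>a b :: nat. a \<ge> 12 \<and> b \<ge> 12 \<longrightarrow>
            rank_count 1 2 a * rank_count 1 2 b > rank_count 1 2 (a + b))"
proof -
  have even: "signed_rank_count 1 n = 2 * int (rank_count 0 2 n)"
    and odd: "signed_rank_count (-1) n = 2 * int (rank_count 1 2 n)" for n
    using rank_count_partitions[of n] by (simp_all add: signed_rank_count_def)
  show ?thesis
  proof (intro conjI allI impI; elim conjE)
    fix a b :: nat assume "11 \<le> a" "11 \<le> b"
    then have "int (rank_count 0 2 (a + b)) < int (rank_count 0 2 a * rank_count 0 2 b)"
      using even_rank_products[of a b] by (simp add: even)
    then show "rank_count 0 2 (a + b) < rank_count 0 2 a * rank_count 0 2 b"
      by (simp only: of_nat_less_iff)
  next
    fix a b :: nat assume "12 \<le> a" "12 \<le> b"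
    then have "int (rank_count 1 2 (a + b)) < int (rank_count 1 2 a * rank_count 1 2 b)"
      using odd_rank_products[of a b] by (simp add: odd)
    then show "rank_count 1 2 (a + b) < rank_count 1 2 a * rank_count 1 2 b"
      by (simp only: of_nat_less_iff)
  qed
qed

end
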